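(* For every 3-uniform hypergraph $H$ with $R_2(H)\geq 7$, we have $f(H,\mathcal{M})=R_2(H)$.
   Context: For a 3-graph $H$, $R_2(H)$ is the minimum $n$ such that every 2-edge-coloring of $K^{(3)}_n$ contains a monochromatic copy of $H$. The constrained Ramsey number $f(H,G)$ is the minimum $n$ such that every edge-coloring of $K^{(3)}_n$ with any number of colors contains either a monochromatic copy of $H$ or a rainbow copy of $G$ (all edges of distinct colors). The messy path $\mathcal{M}$ is the 3-graph with vertices $v_1,\ldots,v_6$ and edges $\{v_1v_2v_3,v_2v_3v_4,v_4v_5v_6\}$. *)

theory Defs
  imports Main
begin

type_synonym 'a hypergraph = "'a set \<times> 'a set set"

abbreviation hverts :: "'a hypergraph \<Rightarrow> 'a set" where "hverts H \<equiv> fst H"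
abbreviation hedges :: "'a hypergraph \<Rightarrow> 'a set set" where "hedges H \<equiv> snd H"

definition three_graph :: "'a hypergraph \<Rightarrow> bool" where
  "three_graph H \<longleftrightarrow> finite (hverts H) \<and> (\<forall>e\<in>hedges H. e \<subseteq> hverts H \<and> card e = 3)"

definition complete3 :: "nat \<Rightarrow> nat hypergraph" where
  "complete3 n = ({..<n}, {e. e \<subseteq> {..<n} \<and> card e = 3})"

text \<open>Copies are not required to be induced.\<close>

definition is_embedding :: "('a \<Rightarrow> 'b) \<Rightarrow> 'a hypergraph \<Rightarrow> 'b hypergraph \<Rightarrow> bool" where
  "is_embedding \<phi> H K \<longleftrightarrow>
     inj_on \<phi> (hverts H) \<and> \<phi> ` hverts H \<subseteq> hverts K \<and> (\<forall>e\<in>hedges H. \<phi> ` e \<in> hedges K)"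

definition has_mono_copy :: "'a hypergraph \<Rightarrow> 'b hypergraph \<Rightarrow> ('b set \<Rightarrow> 'c) \<Rightarrow> bool" where
  "has_mono_copy H K c \<longleftrightarrow>
     (\<exists>\<phi>. is_embedding \<phi> H K \<and> (\<exists>k. \<forall>e\<in>hedges H. c (\<phi> ` e) = k))"

definition has_rainbow_copy :: "'a hypergraph \<Rightarrow> 'b hypergraph \<Rightarrow> ('b set \<Rightarrow> 'c) \<Rightarrow> bool" where
  "has_rainbow_copy G K c \<longleftrightarrow>
     (\<exists>\<phi>. is_embedding \<phi> G K \<and> inj_on (\<lambda>e. c (\<phi> ` e)) (hedges G))"

text \<open>
  A colouring is a total function on vertex sets, of which only the values on edges matter.
  On natural numbers the infimum of a nonempty set is its minimum and that of the empty set is 0;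
  hence a positive value of the two numbers below also says that the minimum exists.
\<close>

definition ramsey2 :: "'a hypergraph \<Rightarrow> nat" where
  "ramsey2 H = Inf {n. \<forall>c :: nat set \<Rightarrow> nat.
     c ` hedges (complete3 n) \<subseteq> {0, 1} \<longrightarrow> has_mono_copy H (complete3 n) c}"

text \<open>
  Complete 3-graphs being finite, colours in the natural numbers account for colourings with
  any number of colours.
\<close>

definition constrained_ramsey :: "'a hypergraph \<Rightarrow> 'b hypergraph \<Rightarrow> nat" where
  "constrained_ramsey H G = Inf {n. \<forall>c :: nat set \<Rightarrow> nat.
     has_mono_copy H (complete3 n) c \<or> has_rainbow_copy G (complete3 n) c}"

definition messy_path :: "nat hypergraph" where
  "messy_path = ({1..6}, {{1, 2, 3}, {2, 3, 4}, {4, 5, 6}})"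

end

theory Submission
  imports Defs
begin

text \<open>
  A 2-colouring has no rainbow messy path, which has three edges. Conversely, on at least seven
  vertices a colouring \<open>c\<close> without rainbow messy path uses at most two colours, so the two families of
  admissible \<open>n\<close> coincide beyond 6. Indeed, unless \<open>c\<close> is constant there are edges \<open>abx\<close> and \<open>aby\<close>
  of distinct colours; an edge \<open>g\<close> of a third colour lies with them in a set of seven vertices
  \<open>a, b, x, y, p, q, r\<close>, and for each position of \<open>g\<close> relative to \<open>a, b, x, y\<close> a few messy paths
  force a contradiction. Six vertices do not suffice: colour complementary triples alike.
\<close>

lemma has_rainbow_copy_messy_pathI:
  assumes "distinct [u, v, w, x, y, z]" "{u, v, w, x, y, z} \<subseteq> {..<n}"
    and "c {u, v, w} \<noteq> c {v, w, x}" "c {u, v, w} \<noteq> c {x, y, z}" "c {v, w, x} \<noteq> c {x, y, z}"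
  shows "has_rainbow_copy messy_path (complete3 n) c"
proof -
  \<comment> \<open>Path vertices are numbered from 1, list positions from 0.\<close>
  define \<phi> where "\<phi> = (\<lambda>i::nat. [u, v, w, x, y, z] ! (i - 1))"
  have verts: "{Suc 0..6} = {1, 2, 3, 4, 5, 6}" by auto
  have \<phi>: "\<phi> 1 = u" "\<phi> (Suc 0) = u" "\<phi> 2 = v" "\<phi> 3 = w" "\<phi> 4 = x" "\<phi> 5 = y" "\<phi> 6 = z"
    by (simp_all add: \<phi>_def)
  have "is_embedding \<phi> messy_path (complete3 n)"
    using assms(1,2) by (simp add: is_embedding_def messy_path_def complete3_def verts \<phi>)
  moreover have "inj_on (\<lambda>e. c (\<phi> ` e)) (hedges messy_path)"
    using assms(3-5) by (auto simp: messy_path_def inj_on_def \<phi>)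
  ultimately show ?thesis
    unfolding has_rainbow_copy_def by blast
qed

lemma no_rainbow_messy_path_of_two_colours:
  assumes "c ` hedges (complete3 n) \<subseteq> {i, j}"
  shows "\<not> has_rainbow_copy messy_path (complete3 n) c"
proof
  assume "has_rainbow_copy messy_path (complete3 n) c"
  then obtain \<phi> where \<phi>: "is_embedding \<phi> messy_path (complete3 n)"
    and inj: "inj_on (\<lambda>e. c (\<phi> ` e)) (hedges messy_path)"
    unfolding has_rainbow_copy_def by blast
  have "{1, 2, 3} \<noteq> {2, 3, 4 :: nat}" "{1, 2, 3} \<noteq> {4, 5, 6 :: nat}" "{2, 3, 4} \<noteq> {4, 5, 6 :: nat}"
    by (simp_all add: set_eq_iff) presburger+
  then have "card (hedges messy_path) = 3"
    by (simp add: messy_path_def)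
  moreover have "(\<lambda>e. c (\<phi> ` e)) ` hedges messy_path \<subseteq> {i, j}"
    using \<phi> assms unfolding is_embedding_def by blast
  then have "card (hedges messy_path) \<le> card {i, j}"
    using inj by (intro card_inj_on_le) auto
  moreover have "card {i, j} \<le> 2"
    by (simp add: card_insert_if)
  ultimately show False by simp
qed

text \<open>Walk from \<open>e\<close> to \<open>f\<close> by exchanging one element at a time: the
  colour must change at some exchange, and \<open>d\<close> is what the sets before and after it
  share.\<close>

lemma ex_adjacent_sets_of_distinct_colour:
  assumes "finite e" "finite f" "card e = card f" "e \<union> f \<subseteq> S" "c e \<noteq> c f"
  shows "\<exists>d x y. insert x (insert y d) \<subseteq> S \<and> Suc (card d) = card e \<and> finite d
    \<and> x \<notin> d \<and> y \<notin> d \<and> x \<noteq> y \<and> c (insert x d) \<noteq> c (insert y d)"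
  using assms
proof (induction "card (e - f)" arbitrary: e rule: less_induct)
  case less
  have "\<not> e \<subseteq> f" "\<not> f \<subseteq> e"
    using less.prems card_subset_eq by metis+
  then obtain x y where xy: "x \<in> e" "x \<notin> f" "y \<in> f" "y \<notin> e" by blast
  let ?d = "e - {x}"
  have card_d: "Suc (card ?d) = card e"
    using less.prems(1) xy(1) by (rule card_Suc_Diff1)
  show ?case
  proof (cases "c (insert y ?d) = c e")
    \<comment> \<open>The exchanged set has the colour of \<open>e\<close> and is one element nearer
      to \<open>f\<close>, so the induction hypothesis applies to it.\<close>
    case True
    have "insert y ?d - f = (e - f) - {x}" using xy by auto
    then have "card (insert y ?d - f) < card (e - f)"
      using xy less.prems(1) by (metis DiffI card_Diff1_less finite_Diff)
    moreover have eq: "card (insert y ?d) = card e"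
      using xy less.prems(1) card_d by (simp del: card_Diff_insert)
    moreover have "insert y ?d \<union> f \<subseteq> S"
      using less.prems(4) xy by blast
    ultimately show ?thesis
      using less.hyps[of "insert y ?d"] less.prems(1-3,5) True unfolding eq by simp
  next
    case False
    moreover have "insert x ?d = e" using xy by auto
    moreover have "insert x (insert y ?d) \<subseteq> S"
      using less.prems(4) xy by blast
    ultimately show ?thesis
      using card_d xy less.prems(1)
      by (intro exI[of _ ?d] exI[of _ x] exI[of _ y] conjI) auto
  qed
qed

locale no_rainbow_messy_path =
  fixes c :: "'v set \<Rightarrow> 'c" and S :: "'v set"
  assumes no_rainbow: "distinct [u, v, w, x, y, z] \<Longrightarrow> {u, v, w, x, y, z} \<subseteq> S \<Longrightarrow>
    c {u, v, w} = c {v, w, x} \<or> c {u, v, w} = c {x, y, z} \<or> c {v, w, x} = c {x, y, z}"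
begin

text \<open>Below, A and B are the colours of \<open>abx\<close> and \<open>aby\<close>, and C is a
  supposed third colour of the triple in question. Up to exchanging \<open>a\<close> with
  \<open>b\<close>, exchanging \<open>x\<close> with \<open>y\<close> and permuting
  \<open>p, q, r\<close>, the seven lemmas cover every position of a triple other than
  \<open>abx\<close> and \<open>aby\<close>.\<close>

context
  fixes a b x y p q r
  assumes dist: "distinct [a, b, x, y, p, q, r]" and sub: "{a, b, x, y, p, q, r} \<subseteq> S"
    and neq: "c {a, b, x} \<noteq> c {a, b, y}"
begin

text \<open>The path \<open>yab, abx, xpq\<close> opens with the colours B and A, so its last edge
  repeats one of them.\<close>

lemma colour_xpq: "c {x, p, q} \<in> {c {a, b, x}, c {a, b, y}}"
  using dist sub neq no_rainbow[of y a b x p q]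
  by (auto simp: insert_commute)

text \<open>With C on \<open>abp\<close>, the paths whose first two edges share \<open>ab\<close>
  force A on \<open>ypq\<close> and B on \<open>yqr\<close>; then \<open>rqy, qyp, pab\<close> is
  rainbow.\<close>

lemma colour_abp: "c {a, b, p} \<in> {c {a, b, x}, c {a, b, y}}"
  using dist sub neq no_rainbow[of p a b y q r] no_rainbow[of x a b p q y] no_rainbow[of x a b y p q]
    no_rainbow[of x a b y q r] no_rainbow[of r q y p a b]
  by (simp add: insert_commute) (smt (verit))

lemma colour_axy: "c {a, x, y} \<in> {c {a, b, x}, c {a, b, y}}"
  using dist sub neq no_rainbow[of b a y x q r] no_rainbow[of y a b x q r] no_rainbow[of x a y b p r]
    no_rainbow[of p q r x a b] no_rainbow[of y a x b p r] no_rainbow[of q p r b a x]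
    no_rainbow[of p q r x a y]
  by (simp add: insert_commute) (smt (verit))

text \<open>C on \<open>axp\<close> forces B in turn on \<open>xpq\<close>, \<open>yqr\<close> and
  \<open>bry\<close>; then \<open>pax, axb, bry\<close> has the colours C, A, B.\<close>

lemma colour_axp: "c {a, x, p} \<in> {c {a, b, x}, c {a, b, y}}"
  using dist sub neq no_rainbow[of q p x a b y] no_rainbow[of r b y a p x] no_rainbow[of y a b x p q]
    no_rainbow[of x a b y q r] no_rainbow[of a p x q r y] no_rainbow[of q r y b a x]
    no_rainbow[of p a x b r y]
  by (simp add: insert_commute) (smt (verit))

text \<open>C on \<open>apq\<close> spreads to \<open>pqr\<close> and then to \<open>xpq\<close>,
  which the path \<open>yab, abx, xpq\<close> forbids.\<close>

lemma colour_apq: "c {a, p, q} \<in> {c {a, b, x}, c {a, b, y}}"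
  using dist sub neq no_rainbow[of r p q a b y] no_rainbow[of r p q a b x] no_rainbow[of r p q x a b]
    no_rainbow[of x p q a b y] no_rainbow[of y a b x p q]
  by (simp add: insert_commute) (smt (verit))

text \<open>C on \<open>xyp\<close> forces C on \<open>abr\<close> and B on \<open>xpq\<close>; then
  \<open>rab, abx, xpq\<close> is rainbow.\<close>

lemma colour_xyp: "c {x, y, p} \<in> {c {a, b, x}, c {a, b, y}}"
  using dist sub neq no_rainbow[of r a b x p y] no_rainbow[of y a b x p q] no_rainbow[of r a b y p x]
    no_rainbow[of q p x y a b] no_rainbow[of r a b x p q]
  by (simp add: insert_commute) (smt (verit))

text \<open>C on \<open>pqr\<close> spreads to \<open>abr\<close> and then to \<open>xpr\<close>,
  which the path \<open>yab, abx, xpr\<close> forbids.\<close>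

lemma colour_pqr: "c {p, q, r} \<in> {c {a, b, x}, c {a, b, y}}"
  using dist sub neq no_rainbow[of x a b r p q] no_rainbow[of q p r x a b] no_rainbow[of y a b r p q]
    no_rainbow[of y a b r p x] no_rainbow[of y a b x p r]
  by (simp add: insert_commute) (smt (verit))

end

lemma colour_in_pair:
  assumes "distinct [a, b, x, y, p, q, r]" "{a, b, x, y, p, q, r} \<subseteq> S"
    and "c {a, b, x} \<noteq> c {a, b, y}" and "card g = 3" "g \<subseteq> {a, b, x, y, p, q, r}"
  shows "c g \<in> {c {a, b, x}, c {a, b, y}}"
proof -
  define I where "I = {c {a, b, x}, c {a, b, y}}"
  have outer: "c {x, u, v} \<in> I" "c {y, u, v} \<in> I" "c {a, b, u} \<in> I" "c {a, x, u} \<in> I"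
    "c {a, y, u} \<in> I" "c {b, x, u} \<in> I" "c {b, y, u} \<in> I" "c {a, u, v} \<in> I" "c {b, u, v} \<in> I"
    "c {x, y, u} \<in> I" "c {u, v, w} \<in> I"
    if "distinct [u, v, w]" "{u, v, w} = {p, q, r}" for u v w
  proof -
    \<comment> \<open>The lemmas above are reused with \<open>a\<close> and \<open>b\<close>
      exchanged, with \<open>x\<close> and \<open>y\<close> exchanged, and with both; the set
      \<open>I\<close> of two colours stays the same.\<close>
    have *: "distinct [a, b, x, y, u, v, w]" "{a, b, x, y, u, v, w} \<subseteq> S"
      "distinct [b, a, x, y, u, v, w]" "{b, a, x, y, u, v, w} \<subseteq> S"
      "distinct [a, b, y, x, u, v, w]" "{a, b, y, x, u, v, w} \<subseteq> S"
      "distinct [b, a, y, x, u, v, w]" "{b, a, y, x, u, v, w} \<subseteq> S"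
      using assms(1,2) that by auto
    have **: "c {b, a, x} \<noteq> c {b, a, y}" "c {a, b, y} \<noteq> c {a, b, x}" "c {b, a, y} \<noteq> c {b, a, x}"
      using assms(3) by (simp_all add: insert_commute)
    have I: "I = {c {b, a, x}, c {b, a, y}}" "I = {c {a, b, y}, c {a, b, x}}"
      "I = {c {b, a, y}, c {b, a, x}}"
      by (auto simp: I_def insert_commute)
    show "c {x, u, v} \<in> I" "c {a, b, u} \<in> I" "c {a, x, u} \<in> I" "c {a, u, v} \<in> I"
      "c {x, y, u} \<in> I" "c {u, v, w} \<in> I"
      unfolding I_def using *(1,2) assms(3)
      by (rule colour_xpq colour_abp colour_axp colour_apq colour_xyp colour_pqr)+
    show "c {b, x, u} \<in> I" "c {b, u, v} \<in> I"
      unfolding I(1) using *(3,4) **(1) by (rule colour_axp colour_apq)+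
    show "c {y, u, v} \<in> I" "c {a, y, u} \<in> I"
      unfolding I(2) using *(5,6) **(2) by (rule colour_xpq colour_axp)+
    show "c {b, y, u} \<in> I"
      unfolding I(3) using *(7,8) **(3) by (rule colour_axp)
  qed
  have inner: "c {a, b, x} \<in> I" "c {a, b, y} \<in> I" "c {a, x, y} \<in> I" "c {b, x, y} \<in> I"
    using colour_axy[of a b x y p q r] colour_axy[of b a x y p q r] assms(1-3)
    by (auto simp: I_def insert_commute)
  \<comment> \<open>The three rotations bring each of \<open>p, q, r\<close> to the place of
    \<open>u\<close>, and each pair of them to the places of \<open>u, v\<close>.\<close>
  have pqr: "distinct [p, q, r]" "distinct [q, r, p]" "distinct [r, p, q]"
    "{q, r, p} = {p, q, r}" "{r, p, q} = {p, q, r}"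
    using assms(1) by auto
  let ?V = "{a, b, x, y, p, q, r}"
  have triples:
    "\<forall>u\<in>?V. \<forall>v\<in>?V. \<forall>w\<in>?V. u \<noteq> v \<longrightarrow> u \<noteq> w \<longrightarrow> v \<noteq> w \<longrightarrow> c {u, v, w} \<in> I"
    using inner outer[OF pqr(1) refl] outer[OF pqr(2,4)] outer[OF pqr(3,5)]
    by (simp add: insert_commute)
  obtain u v w where g: "g = {u, v, w}" and uvw: "u \<noteq> v" "u \<noteq> w" "v \<noteq> w"
    using assms(4) by (auto simp: card_3_iff)
  have "u \<in> ?V" "v \<in> ?V" "w \<in> ?V"
    using assms(5) g by (simp_all only: insert_subset)
  then have "c g \<in> I"
    unfolding g by (rule triples[rule_format, OF _ _ _ uvw])
  then show ?thesis by (simp add: I_def)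
qed

end

lemma two_colours_of_no_rainbow_messy_path:
  assumes "n \<ge> 7" and "\<not> has_rainbow_copy messy_path (complete3 n) c"
  shows "\<exists>i j. c ` hedges (complete3 n) \<subseteq> {i, j}"
proof (cases "\<exists>e f. e \<in> hedges (complete3 n) \<and> f \<in> hedges (complete3 n) \<and> c e \<noteq> c f")
  case False
  then show ?thesis by blast
next
  case True
  then obtain e f where "e \<union> f \<subseteq> {..<n}" "card e = 3" "card f = 3" "c e \<noteq> c f"
    by (auto simp: complete3_def)
  then obtain d x y where d: "insert x (insert y d) \<subseteq> {..<n}" "card d = 2" "x \<notin> d" "y \<notin> d" "x \<noteq> y"
    "c (insert x d) \<noteq> c (insert y d)"
    using ex_adjacent_sets_of_distinct_colour[of e f "{..<n}" c]
    by (auto simp: card_ge_0_finite)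
  then obtain a b where ab: "d = {a, b}" "a \<noteq> b"
    by (auto simp: card_2_iff)
  have neq: "c {a, b, x} \<noteq> c {a, b, y}"
    using d(6) ab by (simp add: insert_commute)
  interpret no_rainbow_messy_path c "{..<n}"
    using assms(2) has_rainbow_copy_messy_pathI by unfold_locales blast
  have "c g \<in> {c {a, b, x}, c {a, b, y}}" if "g \<in> hedges (complete3 n)" for g
  proof -
    have g: "g \<subseteq> {..<n}" "card g = 3"
      using that by (simp_all add: complete3_def)
    \<comment> \<open>As \<open>n \<ge> 7\<close>, at least three vertices lie outside
      \<open>a, b, x, y\<close>; the part of \<open>g\<close> among them extends to a set
      \<open>T\<close> of exactly three.\<close>
    have "card {a, b, x, y} = 4"
      using d ab by auto
    then have "3 \<le> card ({..<n} - {a, b, x, y})"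
      using assms(1) d(1) ab(1) by (subst card_Diff_subset) auto
    moreover have "card (g - {a, b, x, y}) \<le> 3"
      using g card_mono[of g "g - {a, b, x, y}"] by (auto simp: card_ge_0_finite)
    ultimately obtain T where T: "g - {a, b, x, y} \<subseteq> T" "T \<subseteq> {..<n} - {a, b, x, y}" "card T = 3"
      using g(1) exists_subset_between[of "g - {a, b, x, y}" 3 "{..<n} - {a, b, x, y}"] by auto
    then obtain p q r where "T = {p, q, r}" "distinct [p, q, r]"
      by (auto simp: card_3_iff)
    with T d ab g neq show ?thesis
      by (intro colour_in_pair[of a b x y p q r]) auto
  qed
  then show ?thesis by blast
qed

text \<open>Renaming \<open>i\<close> to 0 and everything else to 1 merges no two colours that
  occur, since only \<open>j\<close> can differ from \<open>i\<close>. This adapts an arbitrary pair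
  of colours to the fixed pair 0, 1 in \<open>ramsey2\<close>.\<close>

lemma has_mono_copy_of_two_colours:
  assumes two: "c ` hedges K \<subseteq> {i, j}"
    and copy: "has_mono_copy H K (\<lambda>e. if c e = i then 0 else 1 :: nat)"
  shows "has_mono_copy H K c"
proof -
  obtain \<phi> k where \<phi>: "is_embedding \<phi> H K"
    and k: "\<And>e. e \<in> hedges H \<Longrightarrow> (if c (\<phi> ` e) = i then 0 else 1 :: nat) = k"
    using copy unfolding has_mono_copy_def by blast
  have "c (\<phi> ` e) = (if k = 0 then i else j)" if "e \<in> hedges H" for e
  proof -
    have "c (\<phi> ` e) \<in> {i, j}"
      using two \<phi> that unfolding is_embedding_def by blast
    then show ?thesis
      using k[OF that] by (auto split: if_splits)
  qed
  with \<phi> show ?thesis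
    unfolding has_mono_copy_def by blast
qed

theorem theorem1p9:
  fixes H :: "'a hypergraph"
  assumes "three_graph H"
    and "ramsey2 H \<ge> 7"
  shows "constrained_ramsey H messy_path = ramsey2 H"
proof -
  let ?R = "{n. \<forall>c :: nat set \<Rightarrow> nat.
     c ` hedges (complete3 n) \<subseteq> {0, 1} \<longrightarrow> has_mono_copy H (complete3 n) c}"
  let ?F = "{n. \<forall>c :: nat set \<Rightarrow> nat.
     has_mono_copy H (complete3 n) c \<or> has_rainbow_copy messy_path (complete3 n) c}"
  have "n \<in> ?R" if n: "n \<in> ?F" for n
  proof (intro CollectI allI impI)
    fix c :: "nat set \<Rightarrow> nat"
    assume "c ` hedges (complete3 n) \<subseteq> {0, 1}"
    then have "\<not> has_rainbow_copy messy_path (complete3 n) c"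
      by (rule no_rainbow_messy_path_of_two_colours)
    then show "has_mono_copy H (complete3 n) c"
      using n by blast
  qed
  moreover have "n \<in> ?F" if n: "n \<in> ?R" for n
  proof -
    \<comment> \<open>Each member of \<open>?R\<close> is at least its infimum
      \<open>ramsey2 H\<close>, so six or fewer vertices are excluded.\<close>
    have "7 \<le> n"
      using assms(2) cInf_lower[OF n] by (simp add: ramsey2_def)
    moreover have "has_mono_copy H (complete3 n) c"
      if "c ` hedges (complete3 n) \<subseteq> {i, j}" for c :: "nat set \<Rightarrow> nat" and i j
    proof -
      have "has_mono_copy H (complete3 n) (\<lambda>e. if c e = i then 0 else 1 :: nat)"
        by (rule CollectD[OF n, rule_format]) auto
      then show ?thesis
        by (rule has_mono_copy_of_two_colours[OF that])
    qed
    ultimately have "has_mono_copy H (complete3 n) c \<or> has_rainbow_copy messy_path (complete3 n) c"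
      for c :: "nat set \<Rightarrow> nat"
      using two_colours_of_no_rainbow_messy_path[of n c] by metis
    then show ?thesis by simp
  qed
  ultimately have "?F = ?R" by (intro equalityI subsetI)
  then show ?thesis
    by (simp add: constrained_ramsey_def ramsey2_def)
qed

end
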